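(* Let $(G,S)$ be a quasilattice ordered group. Then $I_l(S)\cup\{0\}=\mathcal{T}(G,S)\cup\{0\}$ as subsets of $I(S)$, where $0$ is the empty partial map.
   Context: Let $G$ be a group and $S\subset G$ a subsemigroup (containing the identity). $(G,S)$ is quasilattice ordered if: $S\cap S^{-1}=\{1\}$; $S$ generates $G$; and, for the partial order on $G$ defined by $g\le h$ iff $g^{-1}h\in S$, any finite family of elements of $G$ that has a common upper bound in $S$ has a least common upper bound in $S$. $I(S)$ is the inverse semigroup of all partially defined bijections of $S$ (product $fg$ is composition on $g^{-1}(\mathrm{dom} f)$; $f^*$ is the inverse map; the empty map is the zero). For $s\in S$, $\lambda_s:S\to sS$, $\lambda_s(t)=st$; $I_l(S)$ is the inverse subsemigroup of $I(S)$ generated by $\{\lambda_s\}_{s\in S}$. For $g\in G$ let $\beta_g:\{s\in S:gs\in S\}\to\{s\in S:g^{-1}s\in S\}$, $\beta_g(s)=gs$. $\mathcal{T}(G,S)$ (the Toeplitz inverse semigroup) is the inverse subsemigroup of $I(S)$ generated by $\{\beta_g\}_{g\in G}$. *)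

theory Defs
  imports "HOL-Algebra.Algebra"
begin

definition left_order :: "('a, 'b) monoid_scheme \<Rightarrow> 'a set \<Rightarrow> 'a gorder"
  where "left_order G S =
    \<lparr>carrier = carrier G, eq = (=), le = (\<lambda>g h. inv\<^bsub>G\<^esub> g \<otimes>\<^bsub>G\<^esub> h \<in> S)\<rparr>"

(* The family F ranges over finite subsets of the whole group, while the bounds are
   taken in S: the bound u is least among the common upper bounds of F that lie in S. *)
locale quasilattice_ordered_group = group G + submonoid S G
  for G (structure) and S +
  assumes S_inter_inv: "S \<inter> set_inv S = {\<one>}"
    and S_generates: "generate G S = carrier G"
    and ex_least_upper_bound:
      "\<lbrakk>finite F; F \<subseteq> carrier G; Upper (left_order G S) F \<inter> S \<noteq> {}\<rbrakk>
        \<Longrightarrow> \<exists>u. least (left_order G S) u (Upper (left_order G S) F \<inter> S)"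

(* A partially defined bijection of S is an injective map between two subsets of S.
   The product fg is the library composition f \<circ>\<^sub>m g, defined at t iff
   g is defined at t and f is defined at the value; the zero is Map.empty. *)
definition partial_bijections :: "'a set \<Rightarrow> ('a \<rightharpoonup> 'a) set"
  where "partial_bijections S = {f. dom f \<subseteq> S \<and> ran f \<subseteq> S \<and> inj_on f (dom f)}"

definition partial_inverse :: "('a \<rightharpoonup> 'a) \<Rightarrow> ('a \<rightharpoonup> 'a)"
  where "partial_inverse f = (\<lambda>y. if y \<in> ran f then Some (THE x. f x = Some y) else None)"

inductive_set inverse_semigroup_generated :: "('a \<rightharpoonup> 'a) set \<Rightarrow> ('a \<rightharpoonup> 'a) set"
  for A where
    generator: "f \<in> A \<Longrightarrow> f \<in> inverse_semigroup_generated A"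
  | product: "f \<in> inverse_semigroup_generated A \<Longrightarrow> g \<in> inverse_semigroup_generated A
      \<Longrightarrow> f \<circ>\<^sub>m g \<in> inverse_semigroup_generated A"
  | inverse: "f \<in> inverse_semigroup_generated A
      \<Longrightarrow> partial_inverse f \<in> inverse_semigroup_generated A"

definition left_translation :: "('a, 'b) monoid_scheme \<Rightarrow> 'a set \<Rightarrow> 'a \<Rightarrow> ('a \<rightharpoonup> 'a)"
  where "left_translation G S s = (\<lambda>t. if t \<in> S then Some (s \<otimes>\<^bsub>G\<^esub> t) else None)"

definition left_inverse_hull :: "('a, 'b) monoid_scheme \<Rightarrow> 'a set \<Rightarrow> ('a \<rightharpoonup> 'a) set"
  where "left_inverse_hull G S = inverse_semigroup_generated (left_translation G S ` S)"

definition partial_translation :: "('a, 'b) monoid_scheme \<Rightarrow> 'a set \<Rightarrow> 'a \<Rightarrow> ('a \<rightharpoonup> 'a)"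
  where "partial_translation G S g =
    (\<lambda>s. if s \<in> S \<and> g \<otimes>\<^bsub>G\<^esub> s \<in> S then Some (g \<otimes>\<^bsub>G\<^esub> s) else None)"

definition toeplitz_inverse_semigroup :: "('a, 'b) monoid_scheme \<Rightarrow> 'a set \<Rightarrow> ('a \<rightharpoonup> 'a) set"
  where "toeplitz_inverse_semigroup G S =
    inverse_semigroup_generated (partial_translation G S ` carrier G)"

lemma partial_inverse_eq_Some_iff:
  assumes "inj_on f (dom f)"
  shows "partial_inverse f y = Some x \<longleftrightarrow> f x = Some y"
proof -
  have uniq: "x' = x" if "f x = Some y" "f x' = Some y" for x x'
    using assms that by (metis domI inj_onD)
  have "(THE x. f x = Some y) = x" if "f x = Some y" for x
    using uniq that by blast
  then show ?thesis
    by (auto simp: partial_inverse_def ran_def)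
qed

lemma partial_bijections_comp:
  assumes "f \<in> partial_bijections S" "g \<in> partial_bijections S"
  shows "f \<circ>\<^sub>m g \<in> partial_bijections S"
proof -
  have "inj_on (f \<circ>\<^sub>m g) (dom (f \<circ>\<^sub>m g))"
  proof (rule inj_onI)
    fix x y
    assume xy: "x \<in> dom (f \<circ>\<^sub>m g)" "y \<in> dom (f \<circ>\<^sub>m g)" "(f \<circ>\<^sub>m g) x = (f \<circ>\<^sub>m g) y"
    then obtain a b c where "g x = Some a" "g y = Some b" "f a = Some c" "f b = Some c"
      by (auto simp: map_comp_def split: option.splits)
    moreover from this have "a = b"
      using assms(1) by (auto simp: partial_bijections_def intro: inj_onD)
    ultimately show "x = y"
      using assms(2) by (auto simp: partial_bijections_def intro: inj_onD)
  qed
  moreover have "dom (f \<circ>\<^sub>m g) \<subseteq> dom g"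
    by (auto simp: map_comp_def split: option.splits)
  moreover have "ran (f \<circ>\<^sub>m g) \<subseteq> ran f"
    by (auto simp: map_comp_def ran_def split: option.splits)
  ultimately show ?thesis
    using assms unfolding partial_bijections_def by blast
qed

lemma partial_bijections_inverse:
  assumes "f \<in> partial_bijections S"
  shows "partial_inverse f \<in> partial_bijections S"
proof -
  have inj: "inj_on f (dom f)" and dr: "dom f \<subseteq> S" "ran f \<subseteq> S"
    using assms by (auto simp: partial_bijections_def)
  note iff = partial_inverse_eq_Some_iff[OF inj]
  have "dom (partial_inverse f) = ran f" "ran (partial_inverse f) = dom f"
    by (auto simp: dom_def ran_def iff)
  moreover have "inj_on (partial_inverse f) (dom (partial_inverse f))"
  proof (rule inj_onI)
    fix x y
    assume "x \<in> dom (partial_inverse f)" "partial_inverse f x = partial_inverse f y"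
    then obtain z where "partial_inverse f x = Some z" "partial_inverse f y = Some z"
      by (metis domD)
    then show "x = y"
      unfolding iff by simp
  qed
  ultimately show ?thesis
    using dr by (auto simp: partial_bijections_def)
qed

lemma inverse_semigroup_generated_subset:
  assumes "A \<subseteq> partial_bijections S"
  shows "inverse_semigroup_generated A \<subseteq> partial_bijections S"
proof
  fix f assume "f \<in> inverse_semigroup_generated A"
  then show "f \<in> partial_bijections S"
    using assms
    by induction (auto intro: partial_bijections_comp partial_bijections_inverse)
qed

context quasilattice_ordered_group
begin

lemma left_inverse_hull_subset: "left_inverse_hull G S \<subseteq> partial_bijections S"
  unfolding left_inverse_hull_def
proof (rule inverse_semigroup_generated_subset, clarify)
  fix s assume s: "s \<in> S"
  have "inj_on (left_translation G S s) (dom (left_translation G S s))"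
    using s subset by (auto intro!: inj_onI simp: left_translation_def split: if_splits)
  then show "left_translation G S s \<in> partial_bijections S"
    using s by (auto simp: partial_bijections_def left_translation_def ran_def split: if_splits)
qed

lemma toeplitz_inverse_semigroup_subset:
  "toeplitz_inverse_semigroup G S \<subseteq> partial_bijections S"
  unfolding toeplitz_inverse_semigroup_def
proof (rule inverse_semigroup_generated_subset, clarify)
  fix g assume g: "g \<in> carrier G"
  have "inj_on (partial_translation G S g) (dom (partial_translation G S g))"
    using g subset by (auto intro!: inj_onI simp: partial_translation_def split: if_splits)
  then show "partial_translation G S g \<in> partial_bijections S"
    by (auto simp: partial_bijections_def partial_translation_def ran_def split: if_splits)
qed

end

end

theory Submission
  imports Defs
begin

text \<open>
  The domain of \<open>\<beta>\<^sub>g\<close> is the set of common upper bounds of \<open>1\<close> and \<open>g\<inverse>\<close>.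
  If it is nonempty, its least element \<open>u\<close> gives \<open>dom \<beta>\<^sub>g = uS\<close>, and hence
  \<open>\<beta>\<^sub>g = \<lambda>\<^bsub>gu\<^esub> \<lambda>\<^sub>u\<^sup>*\<close>. Conversely \<open>\<lambda>\<^sub>s = \<beta>\<^sub>s\<close> for \<open>s \<in> S\<close>.
\<close>

lemma map_comp_empty_left [simp]: "Map.empty \<circ>\<^sub>m f = Map.empty"
  by (auto simp: map_comp_def fun_eq_iff split: option.splits)

lemma partial_inverse_empty [simp]: "partial_inverse Map.empty = Map.empty"
  by (auto simp: partial_inverse_def)

text \<open>The empty map is absorbing for \<open>\<circ>\<^sub>m\<close> and is its own inverse, so
  the right-hand side is closed under products and inverses. Both inclusions of the theorem thereby
  reduce to generators.\<close>

lemma inverse_semigroup_generated_least: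
  assumes "A \<subseteq> inverse_semigroup_generated B \<union> {Map.empty}"
  shows "inverse_semigroup_generated A \<subseteq> inverse_semigroup_generated B \<union> {Map.empty}"
proof
  fix f assume "f \<in> inverse_semigroup_generated A"
  then show "f \<in> inverse_semigroup_generated B \<union> {Map.empty}"
    using assms
    by induction (auto intro: inverse_semigroup_generated.intros)
qed

context quasilattice_ordered_group
begin

lemma mult_inv_mult_cancel:
  assumes "g \<in> carrier G" "u \<in> carrier G" "s \<in> carrier G"
  shows "(g \<otimes> u) \<otimes> (inv u \<otimes> s) = g \<otimes> s"
proof -
  have "u \<otimes> (inv u \<otimes> s) = s"
    using assms by (simp flip: m_assoc)
  with assms show ?thesis
    by (simp add: m_assoc)
qed

text \<open>Closure of \<open>S\<close> under products makes the range condition in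
  \<open>partial_translation\<close> automatic.\<close>

lemma left_translation_eq_partial_translation:
  assumes "s \<in> S"
  shows "left_translation G S s = partial_translation G S s"
  using assms by (auto simp: left_translation_def partial_translation_def fun_eq_iff)

lemma partial_inverse_left_translation:
  assumes "u \<in> S" "s \<in> S"
  shows "partial_inverse (left_translation G S u) s =
    (if inv u \<otimes> s \<in> S then Some (inv u \<otimes> s) else None)"
proof -
  \<comment> \<open>Membership supplies injectivity, so inverting the map amounts to solving
    \<open>u \<otimes> t = s\<close> for \<open>t\<close>.\<close>
  have "left_translation G S u \<in> partial_bijections S"
    using left_inverse_hull_subset assms
    by (auto simp: left_inverse_hull_def intro: inverse_semigroup_generated.generator)
  then have iff: "partial_inverse (left_translation G S u) s = Some t \<longleftrightarrow> t \<in> S \<and> t = inv u \<otimes> s"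
    for t
    using assms subset inv_solve_left[of t u s]
    by (auto simp: partial_bijections_def partial_inverse_eq_Some_iff left_translation_def)
  show ?thesis
    using iff by (cases "partial_inverse (left_translation G S u) s") auto
qed

lemma partial_translation_dom:
  assumes g: "g \<in> carrier G" and ne: "partial_translation G S g \<noteq> Map.empty"
  obtains u where "u \<in> S" "g \<otimes> u \<in> S"
    "\<And>s. s \<in> S \<Longrightarrow> g \<otimes> s \<in> S \<longleftrightarrow> inv u \<otimes> s \<in> S"
proof -
  \<comment> \<open>\<open>inv g\<close> lies below \<open>s\<close> iff
    \<open>inv (inv g) \<otimes> s = g \<otimes> s\<close> is in \<open>S\<close>. The bound
    \<open>1\<close> is encoded by intersecting with \<open>S\<close>, whose elements are exactly
    the upper bounds of \<open>1\<close>.\<close>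
  have upper: "Upper (left_order G S) {inv g} \<inter> S = {s \<in> S. g \<otimes> s \<in> S}"
    using g subset by (auto simp: Upper_def left_order_def)
  moreover have "{s \<in> S. g \<otimes> s \<in> S} \<noteq> {}"
    using ne by (auto simp: partial_translation_def fun_eq_iff split: if_splits)
  ultimately obtain u where "least (left_order G S) u {s \<in> S. g \<otimes> s \<in> S}"
    using ex_least_upper_bound[of "{inv g}"] g by auto
  then have u: "u \<in> S" "g \<otimes> u \<in> S"
    and le: "\<And>s. s \<in> S \<Longrightarrow> g \<otimes> s \<in> S \<Longrightarrow> inv u \<otimes> s \<in> S"
    by (auto simp: least_def left_order_def)
  \<comment> \<open>The domain is upward closed: moving from \<open>u\<close> up to \<open>s\<close>
    multiplies \<open>g \<otimes> u\<close> on the right by an element of \<open>S\<close>.\<close>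
  have "g \<otimes> s \<in> S" if "s \<in> S" "inv u \<otimes> s \<in> S" for s
  proof -
    have "g \<otimes> s = (g \<otimes> u) \<otimes> (inv u \<otimes> s)"
      using g u(1) that(1) subset by (simp add: subsetD mult_inv_mult_cancel)
    then show ?thesis
      using u(2) that(2) by simp
  qed
  with u le show thesis
    by (intro that[of u]) blast+
qed

lemma partial_translation_in_left_inverse_hull:
  assumes g: "g \<in> carrier G"
  shows "partial_translation G S g \<in> left_inverse_hull G S \<union> {Map.empty}"
\<comment> \<open>The empty case, where \<open>inv g\<close> has no upper bound in \<open>S\<close>,
  is absorbed by the adjoined zero.\<close>
proof (cases "partial_translation G S g = Map.empty")
  case False
  then obtain u where u: "u \<in> S" "g \<otimes> u \<in> S"
    and dom: "\<And>s. s \<in> S \<Longrightarrow> g \<otimes> s \<in> S \<longleftrightarrow> inv u \<otimes> s \<in> S"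
    using partial_translation_dom[OF g] by blast
  have hull: "left_translation G S s \<in> left_inverse_hull G S" if "s \<in> S" for s
    using that by (auto simp: left_inverse_hull_def intro: inverse_semigroup_generated.generator)
  then have inv_hull: "partial_inverse (left_translation G S u) \<in> left_inverse_hull G S"
    using u(1) by (auto simp: left_inverse_hull_def intro: inverse_semigroup_generated.inverse)
  have "partial_translation G S g =
      left_translation G S (g \<otimes> u) \<circ>\<^sub>m partial_inverse (left_translation G S u)"
  proof
    fix s
    show "partial_translation G S g s =
      (left_translation G S (g \<otimes> u) \<circ>\<^sub>m partial_inverse (left_translation G S u)) s"
    proof (cases "s \<in> S")
      case True
      \<comment> \<open>This matches the values; \<open>dom\<close> matches the domains.\<close>
      then have "(g \<otimes> u) \<otimes> (inv u \<otimes> s) = g \<otimes> s"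
        using g u(1) subset by (simp add: subsetD mult_inv_mult_cancel)
      with True u dom show ?thesis
        unfolding map_comp_def partial_inverse_left_translation[OF u(1) True]
        by (simp add: partial_translation_def left_translation_def)
    next
      case False
      \<comment> \<open>Elements of the hull are partial bijections of \<open>S\<close>, so they are
        undefined outside \<open>S\<close>.\<close>
      then have "partial_inverse (left_translation G S u) s = None"
        using left_inverse_hull_subset inv_hull by (auto simp: partial_bijections_def)
      with False show ?thesis
        by (simp add: partial_translation_def map_comp_def)
    qed
  qed
  with hull[OF u(2)] inv_hull show ?thesis
    by (auto simp: left_inverse_hull_def intro: inverse_semigroup_generated.product)
qed simp

end

theorem lemma3p3p3:
  fixes G :: "('a, 'b) monoid_scheme" and S :: "'a set"
  assumes "quasilattice_ordered_group G S"
  shows "left_inverse_hull G S \<union> {Map.empty} = toeplitz_inverse_semigroup G S \<union> {Map.empty}"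
proof -
  interpret quasilattice_ordered_group G S
    by (fact assms)
  have "left_translation G S ` S \<subseteq> partial_translation G S ` carrier G"
    using subset by (auto simp: left_translation_eq_partial_translation)
  then have "left_translation G S ` S
      \<subseteq> inverse_semigroup_generated (partial_translation G S ` carrier G) \<union> {Map.empty}"
    by (meson UnI1 inverse_semigroup_generated.generator subset_iff)
  then have "left_inverse_hull G S \<subseteq> toeplitz_inverse_semigroup G S \<union> {Map.empty}"
    unfolding left_inverse_hull_def toeplitz_inverse_semigroup_def
    by (rule inverse_semigroup_generated_least)
  moreover have "toeplitz_inverse_semigroup G S \<subseteq> left_inverse_hull G S \<union> {Map.empty}"
    using partial_translation_in_left_inverse_hull
    unfolding left_inverse_hull_def toeplitz_inverse_semigroup_def
    by (intro inverse_semigroup_generated_least) auto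
  ultimately show ?thesis
    by blast
qed

end
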